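(* Let $F_2$ be the free group of rank $2$ and let $P_2\subset F_2$ be the subgroup generated by the squares of all primitive elements of $F_2$. Then the quotient $F_2/P_2$ is isomorphic to the Klein four-group $\mathbb{Z}/2\mathbb{Z}\times\mathbb{Z}/2\mathbb{Z}$.
   Context: An element of $F_2$ is primitive if it belongs to some two-element generating set of $F_2$. The subgroup $P_2$ is characteristic, hence normal, in $F_2$. *)

theory Defs
  imports "HOL-Algebra.Elementary_Groups"
begin

text \<open>
  Elements of the free group are reduced words over letters. A letter is a pair: the letter \<open>(True, x)\<close> stands
  for the generator \<open>x\<close>, and \<open>(False, x)\<close> for its formal inverse.
\<close>

type_synonym 'a letter = "bool \<times> 'a"

definition inv_letter :: "'a letter \<Rightarrow> 'a letter" where
  "inv_letter l = (\<not> fst l, snd l)"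

definition reduced :: "'a letter list \<Rightarrow> bool" where
  "reduced = successively (\<lambda>k l. l \<noteq> inv_letter k)"

text \<open>Left multiplication of a reduced word by a single letter.\<close>

fun cons_red :: "'a letter \<Rightarrow> 'a letter list \<Rightarrow> 'a letter list" where
  "cons_red l [] = [l]"
| "cons_red l (k # w) = (if k = inv_letter l then w else l # k # w)"

definition free_group :: "'a set \<Rightarrow> 'a letter list monoid" where
  "free_group X =
     \<lparr>carrier = {w. reduced w \<and> snd ` set w \<subseteq> X},
      monoid.mult = (\<lambda>v w. foldr cons_red v w),
      one = []\<rparr>"

definition free_gen :: "'a \<Rightarrow> 'a letter list" where
  "free_gen x = [(True, x)]"

text \<open>The two-element generating sets are those with exactly two distinct elements.\<close>

definition primitive2 :: "('a, 'b) monoid_scheme \<Rightarrow> 'a \<Rightarrow> bool" where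
  "primitive2 G x \<longleftrightarrow>
     (\<exists>S. S \<subseteq> carrier G \<and> card S = 2 \<and> generate G S = carrier G \<and> x \<in> S)"

definition primitive_squares_subgroup :: "('a, 'b) monoid_scheme \<Rightarrow> 'a set" where
  "primitive_squares_subgroup G = generate G {x [^]\<^bsub>G\<^esub> (2::nat) | x. primitive2 G x}"

lemma inv_letter_inv_letter [simp]: "inv_letter (inv_letter l) = l"
  by (simp add: inv_letter_def)

lemma snd_inv_letter [simp]: "snd (inv_letter l) = snd l"
  by (simp add: inv_letter_def)

lemma reduced_Nil [simp]: "reduced []"
  by (simp add: reduced_def)

lemma reduced_single [simp]: "reduced [l]"
  by (simp add: reduced_def)

lemma reduced_Cons_Cons [simp]:
  "reduced (l # k # w) \<longleftrightarrow> k \<noteq> inv_letter l \<and> reduced (k # w)"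
  by (simp add: reduced_def)

lemma reduced_ConsD: "reduced (l # w) \<Longrightarrow> reduced w"
  by (cases w) auto

lemma reduced_cons_red: "reduced w \<Longrightarrow> reduced (cons_red l w)"
  by (cases w) (auto dest: reduced_ConsD)

lemma reduced_foldr: "reduced w \<Longrightarrow> reduced (foldr cons_red v w)"
  by (induction v) (auto intro: reduced_cons_red)

lemma set_cons_red: "set (cons_red l w) \<subseteq> insert l (set w)"
  by (cases w) auto

lemma set_foldr: "set (foldr cons_red v w) \<subseteq> set v \<union> set w"
proof (induction v)
  case (Cons l v)
  then show ?case using set_cons_red[of l "foldr cons_red v w"] by auto
qed simp

lemma snd_set_foldr:
  "snd ` set v \<subseteq> X \<Longrightarrow> snd ` set w \<subseteq> X \<Longrightarrow> snd ` set (foldr cons_red v w) \<subseteq> X"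
  using set_foldr[of v w] by blast

lemma cons_red_cancel: "reduced w \<Longrightarrow> cons_red l (cons_red (inv_letter l) w) = w"
proof (cases w)
  case (Cons k u)
  moreover assume "reduced w"
  ultimately show ?thesis by (cases u) auto
qed auto

lemma cons_red_cancel': "reduced w \<Longrightarrow> cons_red (inv_letter l) (cons_red l w) = w"
  using cons_red_cancel[of w "inv_letter l"] by simp

lemma foldr_cons_red_assoc:
  assumes "reduced w"
  shows "foldr cons_red (foldr cons_red u v) w = foldr cons_red u (foldr cons_red v w)"
proof (induction u)
  case (Cons l u)
  have "foldr cons_red (cons_red l z) w = cons_red l (foldr cons_red z w)" for z
    by (cases z) (auto simp: cons_red_cancel reduced_foldr assms)
  then show ?case using Cons by simp
qed simp

lemma foldr_cons_red_Nil: "reduced w \<Longrightarrow> foldr cons_red w [] = w"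
proof (induction w)
  case (Cons l w)
  then have "foldr cons_red w [] = w" by (blast dest: reduced_ConsD)
  with Cons.prems show ?case by (cases w) auto
qed simp

lemma foldr_inverse: "reduced w \<Longrightarrow> foldr cons_red (rev (map inv_letter v)) (foldr cons_red v w) = w"
  by (induction v arbitrary: w) (auto simp: cons_red_cancel' reduced_foldr)

lemma group_free_group: "group (free_group X)"
proof (rule groupI)
  fix v assume v: "v \<in> carrier (free_group X)"
  let ?u = "foldr cons_red (rev (map inv_letter v)) []"
  have "snd ` set ?u \<subseteq> X"
    using v by (intro snd_set_foldr) (simp_all add: free_group_def image_image)
  then have "?u \<in> carrier (free_group X)"
    by (simp add: free_group_def reduced_foldr)
  moreover have "foldr cons_red ?u v = []"
    using v foldr_inverse[of "[]" v]
    by (simp add: free_group_def foldr_cons_red_assoc foldr_cons_red_Nil)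
  ultimately show "\<exists>u\<in>carrier (free_group X). u \<otimes>\<^bsub>free_group X\<^esub> v = \<one>\<^bsub>free_group X\<^esub>"
    by (intro bexI[of _ ?u]) (simp_all add: free_group_def)
next
  fix v w assume "v \<in> carrier (free_group X)" "w \<in> carrier (free_group X)"
  then show "v \<otimes>\<^bsub>free_group X\<^esub> w \<in> carrier (free_group X)"
    by (simp add: free_group_def reduced_foldr snd_set_foldr)
qed (auto simp: free_group_def foldr_cons_red_assoc)

text \<open>
  The universal property: \<open>free_group X\<close> is generated by \<open>free_gen ` X\<close>, and every map from \<open>X\<close>
  into a group extends to a homomorphism.
\<close>

lemma free_gen_in_carrier: "x \<in> X \<Longrightarrow> free_gen x \<in> carrier (free_group X)"
  by (simp add: free_group_def free_gen_def)

lemma inv_free_gen: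
  assumes "x \<in> X"
  shows "inv\<^bsub>free_group X\<^esub> (free_gen x) = [(False, x)]"
proof -
  interpret group "free_group X" by (rule group_free_group)
  show ?thesis
    using assms
    by (intro inv_equality) (auto simp: free_group_def free_gen_def inv_letter_def)
qed

lemma generate_free_gen: "generate (free_group X) (free_gen ` X) = carrier (free_group X)"
proof
  interpret group "free_group X" by (rule group_free_group)
  show "generate (free_group X) (free_gen ` X) \<subseteq> carrier (free_group X)"
    by (intro generate_incl) (auto intro: free_gen_in_carrier)
  have "w \<in> generate (free_group X) (free_gen ` X)"
    if "reduced w" "snd ` set w \<subseteq> X" for w
    using that
  proof (induction w)
    case Nil
    have "\<one>\<^bsub>free_group X\<^esub> \<in> generate (free_group X) (free_gen ` X)" by (rule generate.one)
    then show ?case by (simp add: free_group_def)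
  next
    case (Cons l w)
    obtain b x where l: "l = (b, x)" by (cases l)
    with Cons.prems have x: "x \<in> X" by simp
    have "[l] \<in> generate (free_group X) (free_gen ` X)"
    proof (cases b)
      case True
      then show ?thesis
        using x generate.incl[of "free_gen x" "free_gen ` X" "free_group X"]
        by (simp add: l free_gen_def)
    next
      case False
      then show ?thesis
        using x generate.inv[of "free_gen x" "free_gen ` X" "free_group X"]
        by (simp add: l inv_free_gen)
    qed
    moreover have "w \<in> generate (free_group X) (free_gen ` X)"
      using Cons by (auto dest: reduced_ConsD)
    ultimately have "[l] \<otimes>\<^bsub>free_group X\<^esub> w \<in> generate (free_group X) (free_gen ` X)"
      by (rule generate.eng)
    moreover have "[l] \<otimes>\<^bsub>free_group X\<^esub> w = l # w"
      using Cons.prems by (cases w) (auto simp: free_group_def)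
    ultimately show ?case by simp
  qed
  then show "carrier (free_group X) \<subseteq> generate (free_group X) (free_gen ` X)"
    by (auto simp: free_group_def)
qed

lemma free_group_extend:
  assumes "group H" and f: "f \<in> X \<rightarrow> carrier H"
  shows "\<exists>h \<in> hom (free_group X) H. \<forall>x\<in>X. h (free_gen x) = f x"
proof -
  interpret H: group H by fact
  define e where "e l = (if fst l then f (snd l) else inv\<^bsub>H\<^esub> (f (snd l)))" for l
  define h where "h w = foldr (\<lambda>l g. e l \<otimes>\<^bsub>H\<^esub> g) w \<one>\<^bsub>H\<^esub>" for w
  have e: "e l \<in> carrier H" if "snd l \<in> X" for l
    using that f by (auto simp: e_def)
  have h: "h w \<in> carrier H" if "snd ` set w \<subseteq> X" for w
    using that by (induction w) (auto simp: h_def e)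
  have e_inv: "e (inv_letter l) = inv\<^bsub>H\<^esub> (e l)" if "snd l \<in> X" for l
    using that f H.inv_inv[of "f (snd l)"] by (auto simp: e_def inv_letter_def Pi_iff)
  have h_cons: "h (cons_red l w) = e l \<otimes>\<^bsub>H\<^esub> h w" if "snd l \<in> X" "snd ` set w \<subseteq> X" for l w
  proof (cases w)
    case Nil
    then show ?thesis by (simp add: h_def)
  next
    case (Cons k u)
    have "e l \<otimes>\<^bsub>H\<^esub> (inv\<^bsub>H\<^esub> (e l) \<otimes>\<^bsub>H\<^esub> h u) = h u"
      using that Cons e[of l] h[of u] by (simp flip: H.m_assoc)
    moreover have "h (a # v) = e a \<otimes>\<^bsub>H\<^esub> h v" for a v by (simp add: h_def)
    ultimately show ?thesis using Cons that by (auto simp: e_inv)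
  qed
  have h_mult: "h (foldr cons_red v w) = h v \<otimes>\<^bsub>H\<^esub> h w"
    if "snd ` set v \<subseteq> X" "snd ` set w \<subseteq> X" for v w
    using that(1)
  proof (induction v)
    case Nil
    then show ?case using h[OF that(2)] by (simp add: h_def)
  next
    case (Cons l v)
    have "snd ` set (foldr cons_red v w) \<subseteq> X"
      using Cons.prems that(2) by (intro snd_set_foldr) auto
    then have "h (foldr cons_red (l # v) w) = e l \<otimes>\<^bsub>H\<^esub> (h v \<otimes>\<^bsub>H\<^esub> h w)"
      using Cons by (simp add: h_cons)
    also have "\<dots> = h (l # v) \<otimes>\<^bsub>H\<^esub> h w"
      using Cons.prems e[of l] h[of v] h[OF that(2)] by (simp add: h_def H.m_assoc)
    finally show ?case .
  qed
  have "h \<in> hom (free_group X) H"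
    by (rule homI) (simp_all add: free_group_def h h_mult)
  moreover have "h (free_gen x) = f x" if "x \<in> X" for x
    using that f H.r_one[of "f x"] by (auto simp: h_def e_def free_gen_def Pi_iff)
  ultimately show ?thesis by blast
qed

text \<open>Normality, which is what makes the quotient by this subgroup a group.\<close>

lemma (in group) primitive2_conj:
  assumes x: "primitive2 G x" and g: "g \<in> carrier G"
  shows "primitive2 G (g \<otimes> x \<otimes> inv g)"
proof -
  let ?c = "\<lambda>y. g \<otimes> y \<otimes> inv g"
  have cancel: "inv g \<otimes> (g \<otimes> z) = z" "g \<otimes> (inv g \<otimes> z) = z" if "z \<in> carrier G" for z
    using that g by (simp_all flip: m_assoc)
  obtain S where S: "S \<subseteq> carrier G" "card S = 2" "generate G S = carrier G" "x \<in> S"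
    using x by (auto simp: primitive2_def)
  have "?c \<in> hom G G"
  proof (rule homI)
    fix y z assume "y \<in> carrier G" "z \<in> carrier G"
    then show "?c (y \<otimes> z) = ?c y \<otimes> ?c z"
      using g by (simp add: m_assoc cancel)
  qed (use g in auto)
  then interpret c: group_hom G G ?c
    by unfold_locales
  have inj: "inj_on ?c (carrier G)"
    using g by (auto intro!: inj_onI)
  have "?c ` carrier G = carrier G"
  proof
    show "carrier G \<subseteq> ?c ` carrier G"
    proof
      fix y assume y: "y \<in> carrier G"
      then have "y = ?c (inv g \<otimes> y \<otimes> g)"
        using g by (simp add: m_assoc cancel)
      then show "y \<in> ?c ` carrier G" using y g by blast
    qed
  qed (use g in auto)
  then have "generate G (?c ` S) = carrier G"
    using c.generate_img[OF S(1)] S(3) by simp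
  moreover have "card (?c ` S) = 2"
    using S(1,2) inj by (metis card_image inj_on_subset)
  ultimately show ?thesis
    unfolding primitive2_def using S g by (intro exI[of _ "?c ` S"]) auto
qed

lemma (in group) normal_primitive_squares_subgroup:
  "primitive_squares_subgroup G \<lhd> G"
  unfolding primitive_squares_subgroup_def
proof (rule normal_generateI)
  have carr: "x \<in> carrier G" if "primitive2 G x" for x
    using that by (auto simp: primitive2_def)
  then show "{x [^] (2::nat) | x. primitive2 G x} \<subseteq> carrier G" by auto
  fix h g assume "h \<in> {x [^] (2::nat) | x. primitive2 G x}" and g: "g \<in> carrier G"
  then obtain x where x: "primitive2 G x" "h = x [^] (2::nat)" by blast
  have cancel: "inv g \<otimes> (g \<otimes> z) = z" if "z \<in> carrier G" for z
    using that g by (simp flip: m_assoc)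
  have "g \<otimes> h \<otimes> inv g = (g \<otimes> x \<otimes> inv g) [^] (2::nat)"
    using carr[OF x(1)] g
    by (simp add: x(2) numeral_2_eq_2 m_assoc cancel)
  then show "g \<otimes> h \<otimes> inv g \<in> {x [^] (2::nat) | x. primitive2 G x}"
    using primitive2_conj[OF x(1) g] by blast
qed

end

theory Submission
  imports Defs
begin

text \<open>
  Let \<open>a, b\<close> be the free generators and let \<open>h\<close> be the homomorphism onto the Klein four-group with
  \<open>a \<mapsto> (1, 0)\<close> and \<open>b \<mapsto> (0, 1)\<close>. It suffices to show that the kernel of \<open>h\<close> is the subgroup \<open>P\<close>
  generated by the squares of the primitive elements.

  The Klein four-group has exponent 2, so \<open>h\<close> kills every square, and \<open>P\<close> lies in the kernel.
  Conversely, \<open>a\<close>, \<open>b\<close> and \<open>ab\<close> are primitive: \<open>{a, b}\<close> and \<open>{a, ab}\<close> are generating sets.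
  Hence the images \<open>A, B\<close> of \<open>a, b\<close> in the quotient by \<open>P\<close> satisfy \<open>A\<^sup>2 = B\<^sup>2 = (AB)\<^sup>2 = 1\<close>,
  the standard relations of the Klein four-group, and the quotient has no elements besides
  \<open>1, A, B, AB\<close> (lemma \<open>coset_reps_of_two_involutions\<close>). So each coset of \<open>P\<close> is represented by one of
  \<open>1, a, b, ab\<close>. As \<open>h\<close> is constant on cosets of \<open>P\<close> and takes distinct values on these four,
  a coset inside the kernel can only be \<open>P\<close> itself.
\<close>

text \<open>
  The relations make \<open>a\<close> and \<open>b\<close> commute, since \<open>ba\<close> is the inverse of \<open>ab\<close>, which is \<open>ab\<close> itself.
  The four listed elements then form a subgroup that contains the generators.
\<close>

lemma (in group) carrier_of_two_involutions:
  assumes ab: "a \<in> carrier G" "b \<in> carrier G"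
    and gen: "generate G {a, b} = carrier G"
    and inv: "a \<otimes> a = \<one>" "b \<otimes> b = \<one>" "(a \<otimes> b) \<otimes> (a \<otimes> b) = \<one>"
  shows "carrier G \<subseteq> {\<one>, a, b, a \<otimes> b}"
proof -
  have inv_eq: "inv a = a" "inv b = b" "inv (a \<otimes> b) = a \<otimes> b"
    using ab inv by (auto intro: inv_equality)
  then have comm: "b \<otimes> a = a \<otimes> b"
    using ab inv_mult_group[of a b] by simp
  have cancel: "a \<otimes> (a \<otimes> z) = z" "b \<otimes> (b \<otimes> z) = z" if "z \<in> carrier G" for z
    using that ab inv by (simp_all flip: m_assoc)
  have comm': "b \<otimes> (a \<otimes> z) = a \<otimes> (b \<otimes> z)" if "z \<in> carrier G" for z
    using that ab comm by (simp flip: m_assoc)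
  have "subgroup {\<one>, a, b, a \<otimes> b} G"
    by (rule subgroupI) (use ab inv inv_eq in \<open>auto simp: m_assoc comm comm' cancel\<close>)
  then have "generate G {a, b} \<subseteq> {\<one>, a, b, a \<otimes> b}"
    by (intro generate_subgroup_incl) auto
  then show ?thesis by (simp add: gen)
qed

text \<open>
  The hypotheses on \<open>N\<close> say that the relations hold in the quotient by \<open>N\<close>, where the previous lemma
  applies. Its conclusion is pulled back to representatives in \<open>G\<close>, since that is where the kernel of a
  homomorphism is to be compared with \<open>N\<close>.
\<close>

lemma (in group) coset_reps_of_two_involutions:
  assumes N: "N \<lhd> G"
    and ab: "a \<in> carrier G" "b \<in> carrier G"
    and gen: "generate G {a, b} = carrier G"
    and sq: "a \<otimes> a \<in> N" "b \<otimes> b \<in> N" "(a \<otimes> b) \<otimes> (a \<otimes> b) \<in> N"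
    and g: "g \<in> carrier G"
  obtains v where "v \<in> {\<one>, a, b, a \<otimes> b}" "g \<in> N #> v"
proof -
  interpret N: normal N G by fact
  interpret Q: group "G Mod N" by (rule N.factorgroup_is_group)
  let ?p = "\<lambda>x. N #> x"
  have "?p \<in> hom G (G Mod N)" by (rule N.r_coset_hom_Mod)
  then interpret p: group_hom G "G Mod N" ?p by unfold_locales
  have p_one: "?p x = \<one>\<^bsub>G Mod N\<^esub>" if "x \<in> N" for x
    using that N.rcos_const by (simp add: FactGroup_def)
  have "?p a \<otimes>\<^bsub>G Mod N\<^esub> ?p a = \<one>\<^bsub>G Mod N\<^esub>"
       "?p b \<otimes>\<^bsub>G Mod N\<^esub> ?p b = \<one>\<^bsub>G Mod N\<^esub>"
       "(?p a \<otimes>\<^bsub>G Mod N\<^esub> ?p b) \<otimes>\<^bsub>G Mod N\<^esub> (?p a \<otimes>\<^bsub>G Mod N\<^esub> ?p b)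
          = \<one>\<^bsub>G Mod N\<^esub>"
    using sq[THEN p_one] ab p.hom_mult by (metis m_closed)+
  note rel = this
  have "generate (G Mod N) {?p a, ?p b} = ?p ` carrier G"
    using p.generate_img[of "{a, b}"] ab by (simp add: gen)
  also have "\<dots> = carrier (G Mod N)"
    by (auto simp: FactGroup_def RCOSETS_def)
  finally have gen_Q: "generate (G Mod N) {?p a, ?p b} = carrier (G Mod N)" .
  have "carrier (G Mod N) \<subseteq>
      {\<one>\<^bsub>G Mod N\<^esub>, ?p a, ?p b, ?p a \<otimes>\<^bsub>G Mod N\<^esub> ?p b}"
    using ab by (intro Q.carrier_of_two_involutions gen_Q rel p.hom_closed)
  moreover have "?p g \<in> carrier (G Mod N)" using g by simp
  ultimately have "?p g \<in> {?p \<one>, ?p a, ?p b, ?p (a \<otimes> b)}"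
    using ab p.hom_mult p.hom_one by auto
  then obtain v where "v \<in> {\<one>, a, b, a \<otimes> b}" "?p g = ?p v" by blast
  moreover have "g \<in> ?p g" using g N.subgroup_axioms by (rule rcos_self)
  ultimately show thesis using that by blast
qed

lemma square_in_primitive_squares_subgroup:
  assumes "group G" "primitive2 G x"
  shows "x \<otimes>\<^bsub>G\<^esub> x \<in> primitive_squares_subgroup G"
proof -
  interpret group G by fact
  have "x \<in> carrier G" using assms(2) by (auto simp: primitive2_def)
  then have "x [^]\<^bsub>G\<^esub> (2::nat) = x \<otimes>\<^bsub>G\<^esub> x" by (simp add: numeral_2_eq_2)
  then show ?thesis
    unfolding primitive_squares_subgroup_def using assms(2)
    by (intro generate.incl) (metis (mono_tags, lifting) mem_Collect_eq)
qed

text \<open>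
  \<open>b\<close> is recovered as \<open>a\<^sup>-\<^sup>1(ab)\<close>. The hypothesis \<open>b \<noteq> \<one>\<close> keeps \<open>a\<close> and \<open>ab\<close> distinct, so that they form a
  set with two elements.
\<close>

lemma (in group) primitive2_mult:
  assumes ab: "a \<in> carrier G" "b \<in> carrier G" "b \<noteq> \<one>"
    and gen: "generate G {a, b} = carrier G"
  shows "primitive2 G (a \<otimes> b)"
proof -
  let ?S = "{a, a \<otimes> b}"
  have S: "?S \<subseteq> carrier G" using ab by simp
  have sub: "subgroup (generate G ?S) G" using S by (rule generate_is_subgroup)
  have in_S: "a \<in> generate G ?S" "a \<otimes> b \<in> generate G ?S"
    by (auto intro: generate.incl)
  then have "inv a \<otimes> (a \<otimes> b) \<in> generate G ?S"
    by (simp add: sub subgroup.m_closed subgroup.m_inv_closed)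
  then have "b \<in> generate G ?S" using ab by (simp flip: m_assoc)
  then have "generate G {a, b} \<subseteq> generate G ?S"
    using in_S by (intro generate_subgroup_incl sub) auto
  then have "generate G ?S = carrier G"
    using gen generate_incl[OF S] by auto
  moreover have "a \<noteq> a \<otimes> b" using ab by simp
  then have "card ?S = 2" by simp
  ultimately show ?thesis unfolding primitive2_def using S by blast
qed

lemma (in group_hom) primitive_squares_subgroup_subset_kernel:
  assumes "\<And>y. y \<in> carrier H \<Longrightarrow> y \<otimes>\<^bsub>H\<^esub> y = \<one>\<^bsub>H\<^esub>"
  shows "primitive_squares_subgroup G \<subseteq> kernel G H h"
  unfolding primitive_squares_subgroup_def
proof (rule G.generate_subgroup_incl[OF _ subgroup_kernel])
  show "{x [^] (2::nat) | x. primitive2 G x} \<subseteq> kernel G H h"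
    using assms by (auto simp: primitive2_def kernel_def numeral_2_eq_2)
qed

abbreviation "klein_four \<equiv> integer_mod_group 2 \<times>\<times> integer_mod_group 2"

lemma carrier_klein_four: "carrier klein_four = {(0, 0), (1, 0), (0, 1), (1, 1)}"
  by (auto simp: DirProd_def carrier_integer_mod_group)

lemma mult_klein_four:
  "(x, y) \<otimes>\<^bsub>klein_four\<^esub> (u, v) = ((x + u) mod 2, (y + v) mod 2)"
  by (simp add: DirProd_def mult_integer_mod_group)

lemma one_klein_four: "\<one>\<^bsub>klein_four\<^esub> = (0, 0)"
  by (simp add: DirProd_def)

lemma group_klein_four: "group klein_four"
  by (simp add: DirProd_group)

theorem proposition2p10:
  fixes X :: "'a set"
  assumes "card X = 2"
  shows "free_group X Mod primitive_squares_subgroup (free_group X)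
           \<cong> integer_mod_group 2 \<times>\<times> integer_mod_group 2"
proof -
  let ?F = "free_group X" and ?P = "primitive_squares_subgroup (free_group X)"
  interpret F: group ?F by (rule group_free_group)
  interpret P: normal ?P ?F by (rule F.normal_primitive_squares_subgroup)
  obtain x y where X: "X = {x, y}" and xy: "x \<noteq> y"
    using assms by (auto simp: card_2_iff)
  define a b where "a = free_gen x" and "b = free_gen y"
  have ab: "a \<in> carrier ?F" "b \<in> carrier ?F"
    by (simp_all add: a_def b_def X free_gen_in_carrier)
  have gen: "generate ?F {a, b} = carrier ?F"
    using generate_free_gen[of X] by (simp add: a_def b_def X)

  obtain h where h: "h \<in> hom ?F klein_four"
    and h_gen: "\<forall>z\<in>X. h (free_gen z) = (if z = x then (1, 0) else (0, 1))"
    using free_group_extend[OF group_klein_four, of "\<lambda>z. if z = x then (1, 0) else (0, 1)" X]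
    by (auto simp: carrier_klein_four)
  interpret V: group klein_four by (rule group_klein_four)
  interpret h: group_hom ?F klein_four h by unfold_locales (rule h)
  have h_a: "h a = (1, 0)" and h_b: "h b = (0, 1)"
    using h_gen xy by (simp_all add: a_def b_def X)
  have "h (a \<otimes>\<^bsub>?F\<^esub> b) = (1, 1)"
    using ab by (simp add: h_a h_b mult_klein_four)
  note h_ab = h_a h_b this

  have P_subset: "?P \<subseteq> kernel ?F klein_four h"
    by (rule h.primitive_squares_subgroup_subset_kernel)
      (auto simp: carrier_klein_four mult_klein_four one_klein_four)
  have "a \<noteq> b" "b \<noteq> \<one>\<^bsub>?F\<^esub>"
    using h_ab h.hom_one by (auto simp: one_klein_four)
  then have "primitive2 ?F a" "primitive2 ?F b" "primitive2 ?F (a \<otimes>\<^bsub>?F\<^esub> b)"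
    using ab gen unfolding primitive2_def[of _ a] primitive2_def[of _ b]
    by (auto intro!: exI[of _ "{a, b}"] F.primitive2_mult)
  note sq = this[THEN square_in_primitive_squares_subgroup[OF F.is_group]]

  have "kernel ?F klein_four h \<subseteq> ?P"
  proof
    fix g assume "g \<in> kernel ?F klein_four h"
    then have g: "g \<in> carrier ?F" and hg: "h g = \<one>\<^bsub>klein_four\<^esub>"
      by (auto simp: kernel_def)
    obtain v where v: "v \<in> {\<one>\<^bsub>?F\<^esub>, a, b, a \<otimes>\<^bsub>?F\<^esub> b}" and gv: "g \<in> ?P #>\<^bsub>?F\<^esub> v"
      using F.coset_reps_of_two_involutions[OF P.normal_axioms ab gen sq g] .
    obtain p where p: "p \<in> ?P" "g = p \<otimes>\<^bsub>?F\<^esub> v"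
      using gv by (auto simp: r_coset_def)
    have v_carr: "v \<in> carrier ?F" using v ab by auto
    have "p \<in> carrier ?F" "h p = \<one>\<^bsub>klein_four\<^esub>"
      using p P_subset unfolding kernel_def by blast+
    then have "h v = h g"
      using p v_carr h.hom_mult V.l_one[OF h.hom_closed] by metis
    then have "v = \<one>\<^bsub>?F\<^esub>"
      using v hg h_ab by (auto simp: one_klein_four)
    then show "g \<in> ?P" using p by simp
  qed
  then have ker: "kernel ?F klein_four h = ?P" using P_subset by blast

  have "carrier klein_four \<subseteq> h ` carrier ?F"
  proof -
    have "h ` {\<one>\<^bsub>?F\<^esub>, a, b, a \<otimes>\<^bsub>?F\<^esub> b} = carrier klein_four"
      unfolding carrier_klein_four using h_ab h.hom_one by (auto simp: one_klein_four)
    then show ?thesis using ab by blast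
  qed
  then have "h ` carrier ?F = carrier klein_four"
    using h.hom_closed by blast
  then have "?F Mod kernel ?F klein_four h \<cong> klein_four"
    by (rule h.FactGroup_iso)
  then show ?thesis by (simp add: ker)
qed

end
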